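(* The contraction rules \[ \frac{A,A,\Gamma\Rightarrow\Delta}{A,\Gamma\Rightarrow\Delta} \qquad\qquad \frac{\Gamma\Rightarrow\Delta,A,A}{\Gamma\Rightarrow\Delta,A} \] are height-preserving admissible in $\mathsf{G3T}^{i}$.
   Context: Formulae are generated from a countable set of propositional variables by $A ::= p \mid \bot \mid A\land A \mid A\lor A \mid A\to A$. The calculus $\mathsf{G3T}^{i}$. Sequents $\Gamma\Rightarrow\Delta$ have $\Gamma,\Delta$ finite multisets of formulae. Initial sequents: $p,\Gamma\Rightarrow\Delta,p$ ($p$ a variable) and $\bot,\Gamma\Rightarrow\Delta$. Rules (premisses / conclusion): - $\land\mathrm L$: $A,B,\Gamma\Rightarrow\Delta$ / $A\land B,\Gamma\Rightarrow\Delta$. - $\lor\mathrm L$: $A,\Gamma\Rightarrow\Delta$ and $B,\Gamma\Rightarrow\Delta$ / $A\lor B,\Gamma\Rightarrow\Delta$. - $\to\!\mathrm L$: $A\to B,\Gamma\Rightarrow\Delta,A$ and $B,\Gamma\Rightarrow\Delta$ / $A\to B,\Gamma\Rightarrow\Delta$. - $\land\mathrm R$: $\Gamma\Rightarrow\Delta,A$ and $\Gamma\Rightarrow\Delta,B$ / $\Gamma\Rightarrow\Delta,A\land B$. - $\lor\mathrm R$: $\Gamma\Rightarrow\Delta,A,B$ / $\Gamma\Rightarrow\Delta,A\lor B$. - $\to\!\mathrm R$: $A,\Gamma\Rightarrow B$ / $\Gamma\Rightarrow\Delta,A\to B$. The height of a derivation is the length of its longest branch (an initial sequent has height $0$). A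 rule is height-preserving admissible if, whenever its premiss has a derivation of height at most $n$, its conclusion has a derivation of height at most $n$. *)

theory Defs
  imports "HOL-Library.Multiset" "HOL-Library.Countable"
begin

datatype 'v form =
    Var 'v
  | Falsum  ("\<^bold>\<bottom>")
  | Conj "'v form" "'v form"  (infixr "\<^bold>\<and>" 70)
  | Disj "'v form" "'v form"  (infixr "\<^bold>\<or>" 65)
  | Impl "'v form" "'v form"  (infixr "\<^bold>\<rightarrow>" 60)

datatype 'v sequent =
  Sequent (ant: "'v form multiset") (suc: "'v form multiset")  (infix "\<turnstile>" 50)

text \<open>
  \<open>G3Ti n S\<close>: the sequent \<open>S\<close> is the root of a derivation tree whose height, the number of
  rule steps along a longest branch, is exactly \<open>n\<close>.
\<close>

inductive G3Ti :: "nat \<Rightarrow> 'v sequent \<Rightarrow> bool" where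
  Init: "G3Ti 0 (add_mset (Var p) \<Gamma> \<turnstile> add_mset (Var p) \<Delta>)"
| BotL: "G3Ti 0 (add_mset \<^bold>\<bottom> \<Gamma> \<turnstile> \<Delta>)"
| ConjL: "G3Ti n (add_mset A (add_mset B \<Gamma>) \<turnstile> \<Delta>)
    \<Longrightarrow> G3Ti (Suc n) (add_mset (A \<^bold>\<and> B) \<Gamma> \<turnstile> \<Delta>)"
| DisjL: "G3Ti m (add_mset A \<Gamma> \<turnstile> \<Delta>) \<Longrightarrow> G3Ti n (add_mset B \<Gamma> \<turnstile> \<Delta>)
    \<Longrightarrow> G3Ti (Suc (max m n)) (add_mset (A \<^bold>\<or> B) \<Gamma> \<turnstile> \<Delta>)"
| ImplL: "G3Ti m (add_mset (A \<^bold>\<rightarrow> B) \<Gamma> \<turnstile> add_mset A \<Delta>) \<Longrightarrow> G3Ti n (add_mset B \<Gamma> \<turnstile> \<Delta>)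
    \<Longrightarrow> G3Ti (Suc (max m n)) (add_mset (A \<^bold>\<rightarrow> B) \<Gamma> \<turnstile> \<Delta>)"
| ConjR: "G3Ti m (\<Gamma> \<turnstile> add_mset A \<Delta>) \<Longrightarrow> G3Ti n (\<Gamma> \<turnstile> add_mset B \<Delta>)
    \<Longrightarrow> G3Ti (Suc (max m n)) (\<Gamma> \<turnstile> add_mset (A \<^bold>\<and> B) \<Delta>)"
| DisjR: "G3Ti n (\<Gamma> \<turnstile> add_mset A (add_mset B \<Delta>))
    \<Longrightarrow> G3Ti (Suc n) (\<Gamma> \<turnstile> add_mset (A \<^bold>\<or> B) \<Delta>)"
| ImplR: "G3Ti n (add_mset A \<Gamma> \<turnstile> {#B#})
    \<Longrightarrow> G3Ti (Suc n) (\<Gamma> \<turnstile> add_mset (A \<^bold>\<rightarrow> B) \<Delta>)"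

definition derivable_within :: "nat \<Rightarrow> 'v sequent \<Rightarrow> bool" where
  "derivable_within n S \<longleftrightarrow> (\<exists>m\<le>n. G3Ti m S)"

text \<open>A one-premiss rule is the set of its instances, as pairs (premiss, conclusion).\<close>

type_synonym 'v rule1 = "('v sequent \<times> 'v sequent) set"

definition hp_admissible :: "'v rule1 \<Rightarrow> bool" where
  "hp_admissible R \<longleftrightarrow>
     (\<forall>(P, C) \<in> R. \<forall>n. derivable_within n P \<longrightarrow> derivable_within n C)"

definition contraction_left :: "'v rule1" where
  "contraction_left =
     {(add_mset A (add_mset A \<Gamma>) \<turnstile> \<Delta>, add_mset A \<Gamma> \<turnstile> \<Delta>) | A \<Gamma> \<Delta>. True}"

definition contraction_right :: "'v rule1" where
  "contraction_right =
     {(\<Gamma> \<turnstile> add_mset A (add_mset A \<Delta>), \<Gamma> \<turnstile> add_mset A \<Delta>) | A \<Gamma> \<Delta>. True}"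

end

theory Submission
  imports Defs
begin

text \<open>
  Contraction is proved by induction on the height bound, simultaneously for all formulae and
  contexts. If the last step does not act on a contracted copy, contract in its premisses and
  repeat the step. If it does, its premisses contain the components of one copy next to the other,
  intact copy. That second copy is replaced by the same components by inverting its rule without
  increasing the height (\<open>inversion_left\<close>, \<open>inversion_right\<close>); the duplicated components are then
  contracted by the induction hypothesis, as they occur in a derivation of smaller height.

  The rules for implication depart from this pattern. The rule \<open>\<rightarrow>R\<close> discards the
  succedent, so \<open>A \<rightarrow> B\<close> on the right has no inversion; but a step introducing one of two copies of
  \<open>A \<rightarrow> B\<close> discards the other one, and its premiss yields the contracted sequent directly. The rule
  \<open>\<rightarrow>L\<close> keeps its principal formula in the left premiss, where both copies can
  therefore be contracted by the induction hypothesis; only the right premiss calls for an inversion.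
\<close>

section \<open>Derivability within a height bound\<close>

text \<open>
  With a bound in place of the exact height, both premisses of a rule can be given the same height,
  and the rules take the uniform form used below.
\<close>

lemma derivable_within_Init:
  "derivable_within n (add_mset (Var p) \<Gamma> \<turnstile> add_mset (Var p) \<Delta>)"
  unfolding derivable_within_def by (blast intro: G3Ti.Init)

lemma derivable_within_BotL:
  "derivable_within n (add_mset \<^bold>\<bottom> \<Gamma> \<turnstile> \<Delta>)"
  unfolding derivable_within_def by (blast intro: G3Ti.BotL)

lemma derivable_within_ConjL:
  assumes "derivable_within n (add_mset A (add_mset B \<Gamma>) \<turnstile> \<Delta>)"
  shows "derivable_within (Suc n) (add_mset (A \<^bold>\<and> B) \<Gamma> \<turnstile> \<Delta>)"
  using assms unfolding derivable_within_def by (meson G3Ti.ConjL Suc_le_mono)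

lemma derivable_within_DisjL:
  assumes "derivable_within n (add_mset A \<Gamma> \<turnstile> \<Delta>)" "derivable_within n (add_mset B \<Gamma> \<turnstile> \<Delta>)"
  shows "derivable_within (Suc n) (add_mset (A \<^bold>\<or> B) \<Gamma> \<turnstile> \<Delta>)"
  using assms unfolding derivable_within_def by (meson G3Ti.DisjL Suc_le_mono max.bounded_iff)

lemma derivable_within_ImplL:
  assumes "derivable_within n (add_mset (A \<^bold>\<rightarrow> B) \<Gamma> \<turnstile> add_mset A \<Delta>)"
    and "derivable_within n (add_mset B \<Gamma> \<turnstile> \<Delta>)"
  shows "derivable_within (Suc n) (add_mset (A \<^bold>\<rightarrow> B) \<Gamma> \<turnstile> \<Delta>)"
  using assms unfolding derivable_within_def by (meson G3Ti.ImplL Suc_le_mono max.bounded_iff)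

lemma derivable_within_ConjR:
  assumes "derivable_within n (\<Gamma> \<turnstile> add_mset A \<Delta>)" "derivable_within n (\<Gamma> \<turnstile> add_mset B \<Delta>)"
  shows "derivable_within (Suc n) (\<Gamma> \<turnstile> add_mset (A \<^bold>\<and> B) \<Delta>)"
  using assms unfolding derivable_within_def by (meson G3Ti.ConjR Suc_le_mono max.bounded_iff)

lemma derivable_within_DisjR:
  assumes "derivable_within n (\<Gamma> \<turnstile> add_mset A (add_mset B \<Delta>))"
  shows "derivable_within (Suc n) (\<Gamma> \<turnstile> add_mset (A \<^bold>\<or> B) \<Delta>)"
  using assms unfolding derivable_within_def by (meson G3Ti.DisjR Suc_le_mono)

lemma derivable_within_ImplR:
  assumes "derivable_within n (add_mset A \<Gamma> \<turnstile> {#B#})"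
  shows "derivable_within (Suc n) (\<Gamma> \<turnstile> add_mset (A \<^bold>\<rightarrow> B) \<Delta>)"
  using assms unfolding derivable_within_def by (meson G3Ti.ImplR Suc_le_mono)

lemmas derivable_within_rules =
  derivable_within_Init derivable_within_BotL derivable_within_ConjL derivable_within_DisjL
  derivable_within_ImplL derivable_within_ConjR derivable_within_DisjR derivable_within_ImplR

lemma derivable_within_cases [consumes 1, case_names Init BotL ConjL DisjL ImplL ConjR DisjR ImplR]:
  assumes "derivable_within n (\<Gamma> \<turnstile> \<Delta>)"
  obtains
    p \<Gamma>' \<Delta>' where "\<Gamma> = add_mset (Var p) \<Gamma>'" "\<Delta> = add_mset (Var p) \<Delta>'"
  | \<Gamma>' where "\<Gamma> = add_mset \<^bold>\<bottom> \<Gamma>'"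
  | k A B \<Gamma>' where "n = Suc k" "\<Gamma> = add_mset (A \<^bold>\<and> B) \<Gamma>'"
      "derivable_within k (add_mset A (add_mset B \<Gamma>') \<turnstile> \<Delta>)"
  | k A B \<Gamma>' where "n = Suc k" "\<Gamma> = add_mset (A \<^bold>\<or> B) \<Gamma>'"
      "derivable_within k (add_mset A \<Gamma>' \<turnstile> \<Delta>)" "derivable_within k (add_mset B \<Gamma>' \<turnstile> \<Delta>)"
  | k A B \<Gamma>' where "n = Suc k" "\<Gamma> = add_mset (A \<^bold>\<rightarrow> B) \<Gamma>'"
      "derivable_within k (add_mset (A \<^bold>\<rightarrow> B) \<Gamma>' \<turnstile> add_mset A \<Delta>)"
      "derivable_within k (add_mset B \<Gamma>' \<turnstile> \<Delta>)"
  | k A B \<Delta>' where "n = Suc k" "\<Delta> = add_mset (A \<^bold>\<and> B) \<Delta>'"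
      "derivable_within k (\<Gamma> \<turnstile> add_mset A \<Delta>')" "derivable_within k (\<Gamma> \<turnstile> add_mset B \<Delta>')"
  | k A B \<Delta>' where "n = Suc k" "\<Delta> = add_mset (A \<^bold>\<or> B) \<Delta>'"
      "derivable_within k (\<Gamma> \<turnstile> add_mset A (add_mset B \<Delta>'))"
  | k A B \<Delta>' where "n = Suc k" "\<Delta> = add_mset (A \<^bold>\<rightarrow> B) \<Delta>'"
      "derivable_within k (add_mset A \<Gamma> \<turnstile> {#B#})"
proof -
  obtain m where "m \<le> n" and d: "G3Ti m (\<Gamma> \<turnstile> \<Delta>)"
    using assms unfolding derivable_within_def by blast
  have premiss: "derivable_within (n - 1) S" if "G3Ti j S" "j < n" for j and S :: "'a sequent"
    using that unfolding derivable_within_def by (intro exI[of _ j]) simp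
  have bound: "n = Suc (n - 1)" if "j < n" for j
    using that by simp
  show thesis
    using d \<open>m \<le> n\<close>
    by cases (auto intro: that(1,2) that(3-8)[of "n - 1"] premiss bound simp: Suc_le_eq)
qed

lemma derivable_within_Suc:
  "derivable_within n S \<Longrightarrow> derivable_within (Suc n) S"
  unfolding derivable_within_def using le_SucI by blast

section \<open>Height-preserving inversion\<close>

text \<open>
  \<open>left_components F R\<close>: some rule introducing \<open>F\<close> on the left has a premiss in which \<open>F\<close> has been
  replaced by \<open>R\<close>; \<open>right_components\<close> is the analogue on the right. The left premiss of \<open>\<rightarrow>L\<close> and the
  premiss of \<open>\<rightarrow>R\<close> are not of this form: one keeps \<open>F\<close>, the other discards its context.
\<close>

inductive left_components :: "'v form \<Rightarrow> 'v form multiset \<Rightarrow> bool" where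
  "left_components (A \<^bold>\<and> B) {#A, B#}"
| "left_components (A \<^bold>\<or> B) {#A#}"
| "left_components (A \<^bold>\<or> B) {#B#}"
| "left_components (A \<^bold>\<rightarrow> B) {#B#}"

inductive right_components :: "'v form \<Rightarrow> 'v form multiset \<Rightarrow> bool" where
  "right_components (A \<^bold>\<and> B) {#A#}"
| "right_components (A \<^bold>\<and> B) {#B#}"
| "right_components (A \<^bold>\<or> B) {#A, B#}"

lemma add_mset_eq_cases:
  assumes "add_mset F \<Gamma> = add_mset P \<Gamma>'"
  obtains (same) "P = F" "\<Gamma>' = \<Gamma>"
  | (other) \<Theta> where "P \<noteq> F" "\<Gamma> = add_mset P \<Theta>" "\<Gamma>' = add_mset F \<Theta>"
  using assms by (metis add_eq_conv_ex)

text \<open>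
  A formula with components is compound, so it is never principal in an initial sequent. If it is
  principal in the last step, a premiss of that step is the required sequent; otherwise it belongs
  to the context and can be replaced in the premisses first.
\<close>

lemma inversion_left:
  assumes "left_components F R" "derivable_within n (add_mset F \<Gamma> \<turnstile> \<Delta>)"
  shows "derivable_within n (R + \<Gamma> \<turnstile> \<Delta>)"
  using assms(2)
proof (induction n arbitrary: \<Gamma> \<Delta> rule: less_induct)
  case (less n)
  have IH: "derivable_within k (R + \<Gamma> \<turnstile> \<Delta>)"
    if "n = Suc k" "derivable_within k (\<Gamma>' \<turnstile> \<Delta>)" "\<Gamma>' = add_mset F \<Gamma>" for k \<Gamma> \<Gamma>' \<Delta>
    using less.IH[of k \<Gamma> \<Delta>] that by simp
  from less.prems show ?case
  proof (cases rule: derivable_within_cases)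
    case (Init p \<Gamma>' \<Delta>')
    with assms(1) show ?thesis
      by (auto elim!: add_mset_eq_cases left_components.cases intro!: derivable_within_rules)
  next
    case (BotL \<Gamma>')
    with assms(1) show ?thesis
      by (auto elim!: add_mset_eq_cases left_components.cases intro!: derivable_within_rules)
  next
    case (ConjL k A B \<Gamma>')
    from ConjL(2) show ?thesis
    proof (cases rule: add_mset_eq_cases)
      case same
      with assms(1) ConjL show ?thesis
        by (auto elim!: left_components.cases intro: derivable_within_Suc)
    next
      case (other \<Theta>)
      with IH[OF ConjL(1,3), of "add_mset A (add_mset B \<Theta>)"] ConjL(1) show ?thesis
        by (auto intro!: derivable_within_rules simp: add_mset_commute)
    qed
  next
    case (DisjL k A B \<Gamma>')
    from DisjL(2) show ?thesis
    proof (cases rule: add_mset_eq_cases)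
      case same
      with assms(1) DisjL show ?thesis
        by (auto elim!: left_components.cases intro: derivable_within_Suc)
    next
      case (other \<Theta>)
      with IH[OF DisjL(1,3), of "add_mset A \<Theta>"] IH[OF DisjL(1,4), of "add_mset B \<Theta>"] DisjL(1)
      show ?thesis
        by (auto intro!: derivable_within_rules simp: add_mset_commute)
    qed
  next
    case (ImplL k A B \<Gamma>')
    from ImplL(2) show ?thesis
    proof (cases rule: add_mset_eq_cases)
      case same
      with assms(1) ImplL show ?thesis
        by (auto elim!: left_components.cases intro: derivable_within_Suc)
    next
      case (other \<Theta>)
      with IH[OF ImplL(1,3), of "add_mset (A \<^bold>\<rightarrow> B) \<Theta>"] IH[OF ImplL(1,4), of "add_mset B \<Theta>"] ImplL(1)
      show ?thesis
        by (auto intro!: derivable_within_rules simp: add_mset_commute)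
    qed
  next
    case (ConjR k A B \<Delta>')
    with IH[OF ConjR(1,3)] IH[OF ConjR(1,4)] show ?thesis
      by (auto intro!: derivable_within_rules)
  next
    case (DisjR k A B \<Delta>')
    with IH[OF DisjR(1,3)] show ?thesis
      by (auto intro!: derivable_within_rules)
  next
    case (ImplR k A B \<Delta>')
    with IH[OF ImplR(1,3), of "add_mset A \<Gamma>"] show ?thesis
      by (auto intro!: derivable_within_rules simp: add_mset_commute)
  qed
qed

text \<open>
  The argument is the same on the right, except after \<open>\<rightarrow>R\<close>: there \<open>F\<close> belonged to the discarded
  context, so nothing is left to invert in the premiss and \<open>R\<close> enters with the step itself.
\<close>

lemma inversion_right:
  assumes "right_components F R" "derivable_within n (\<Gamma> \<turnstile> add_mset F \<Delta>)"
  shows "derivable_within n (\<Gamma> \<turnstile> R + \<Delta>)"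
  using assms(2)
proof (induction n arbitrary: \<Gamma> \<Delta> rule: less_induct)
  case (less n)
  have IH: "derivable_within k (\<Gamma> \<turnstile> R + \<Delta>)"
    if "n = Suc k" "derivable_within k (\<Gamma> \<turnstile> \<Delta>')" "\<Delta>' = add_mset F \<Delta>" for k \<Gamma> \<Delta> \<Delta>'
    using less.IH[of k \<Gamma> \<Delta>] that by simp
  from less.prems show ?case
  proof (cases rule: derivable_within_cases)
    case (Init p \<Gamma>' \<Delta>')
    with assms(1) show ?thesis
      by (auto elim!: add_mset_eq_cases right_components.cases intro!: derivable_within_rules)
  next
    case (BotL \<Gamma>')
    then show ?thesis
      by (auto intro!: derivable_within_rules)
  next
    case (ConjL k A B \<Gamma>')
    with IH[OF ConjL(1,3)] show ?thesis
      by (auto intro!: derivable_within_rules)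
  next
    case (DisjL k A B \<Gamma>')
    with IH[OF DisjL(1,3)] IH[OF DisjL(1,4)] show ?thesis
      by (auto intro!: derivable_within_rules)
  next
    case (ImplL k A B \<Gamma>')
    with IH[OF ImplL(1,3), of "add_mset A \<Delta>"] IH[OF ImplL(1,4)] show ?thesis
      by (auto intro!: derivable_within_rules simp: add_mset_commute)
  next
    case (ConjR k A B \<Delta>')
    from ConjR(2) show ?thesis
    proof (cases rule: add_mset_eq_cases)
      case same
      with assms(1) ConjR show ?thesis
        by (auto elim!: right_components.cases intro: derivable_within_Suc)
    next
      case (other \<Theta>)
      with IH[OF ConjR(1,3), of "add_mset A \<Theta>"] IH[OF ConjR(1,4), of "add_mset B \<Theta>"] ConjR(1)
      show ?thesis
        by (auto intro!: derivable_within_rules simp: add_mset_commute)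
    qed
  next
    case (DisjR k A B \<Delta>')
    from DisjR(2) show ?thesis
    proof (cases rule: add_mset_eq_cases)
      case same
      with assms(1) DisjR show ?thesis
        by (auto elim!: right_components.cases intro: derivable_within_Suc)
    next
      case (other \<Theta>)
      with IH[OF DisjR(1,3), of "add_mset A (add_mset B \<Theta>)"] DisjR(1) show ?thesis
        by (auto intro!: derivable_within_rules simp: add_mset_commute)
    qed
  next
    case (ImplR k A B \<Delta>')
    from ImplR(2) show ?thesis
    proof (cases rule: add_mset_eq_cases)
      case same
      with assms(1) show ?thesis
        by (auto elim: right_components.cases)
    next
      case (other \<Theta>)
      \<comment> \<open>The step discarded this occurrence of \<open>F\<close>; it may equally well discard \<open>R\<close>.\<close>
      with ImplR show ?thesis
        by (auto intro!: derivable_within_rules)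
    qed
  qed
qed

section \<open>Contraction\<close>

lemma add_mset_twice_eq_cases:
  assumes "add_mset F (add_mset F \<Gamma>) = add_mset P \<Gamma>'"
  obtains (same) "P = F" "\<Gamma>' = add_mset F \<Gamma>"
  | (other) \<Theta> where "P \<noteq> F" "\<Gamma> = add_mset P \<Theta>" "\<Gamma>' = add_mset F (add_mset F \<Theta>)"
  using assms by (metis add_eq_conv_ex)

text \<open>
  The formula varies in the induction because a principal copy is contracted by contracting its
  components. For \<open>A \<rightarrow> B\<close> these are not both smaller formulae: the left premiss of \<open>\<rightarrow>L\<close> contracts
  \<open>A \<rightarrow> B\<close> itself. The height alone therefore serves as the induction measure.
\<close>

lemma contraction_left_within:
  "derivable_within n (add_mset F (add_mset F \<Gamma>) \<turnstile> \<Delta>) \<Longrightarrow> derivable_within n (add_mset F \<Gamma> \<turnstile> \<Delta>)"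
proof (induction n arbitrary: F \<Gamma> \<Delta> rule: less_induct)
  case (less n)
  have IH: "derivable_within k (add_mset G \<Gamma> \<turnstile> \<Delta>)"
    if "n = Suc k" "derivable_within k (\<Gamma>' \<turnstile> \<Delta>)" "\<Gamma>' = add_mset G (add_mset G \<Gamma>)"
    for k \<Gamma> \<Gamma>' \<Delta> and G :: "'a form"
    using less.IH[of k G \<Gamma> \<Delta>] that by simp
  from less.prems show ?case
  proof (cases rule: derivable_within_cases)
    case (Init p \<Gamma>' \<Delta>')
    from Init(1) show ?thesis
    proof (cases rule: add_mset_twice_eq_cases)
      case same
      with Init(2) derivable_within_Init[of n p \<Gamma> \<Delta>'] show ?thesis
        by simp
    next
      case (other \<Theta>)
      with Init(2) derivable_within_Init[of n p "add_mset F \<Theta>" \<Delta>'] show ?thesis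
        by (simp add: add_mset_commute)
    qed
  next
    case (BotL \<Gamma>')
    from BotL show ?thesis
    proof (cases rule: add_mset_twice_eq_cases)
      case same
      then show ?thesis
        by (simp add: derivable_within_BotL)
    next
      case (other \<Theta>)
      with derivable_within_BotL[of n "add_mset F \<Theta>" \<Delta>] show ?thesis
        by (simp add: add_mset_commute)
    qed
  next
    case (ConjL k A B \<Gamma>')
    from ConjL(2) show ?thesis
    proof (cases rule: add_mset_twice_eq_cases)
      case same
      have "derivable_within k (add_mset (A \<^bold>\<and> B) (add_mset A (add_mset B \<Gamma>)) \<turnstile> \<Delta>)"
        using ConjL(3) same by (simp add: add_mset_commute)
      then have "derivable_within k (add_mset A (add_mset A (add_mset B (add_mset B \<Gamma>))) \<turnstile> \<Delta>)"
        using inversion_left[OF left_components.intros(1)] by (fastforce simp: add_mset_commute)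
      then have "derivable_within k (add_mset A (add_mset B (add_mset B \<Gamma>)) \<turnstile> \<Delta>)"
        by (rule IH[OF ConjL(1) _ refl])
      then have "derivable_within k (add_mset B (add_mset B (add_mset A \<Gamma>)) \<turnstile> \<Delta>)"
        by (simp add: add_mset_commute)
      then have "derivable_within k (add_mset B (add_mset A \<Gamma>) \<turnstile> \<Delta>)"
        by (rule IH[OF ConjL(1) _ refl])
      then have "derivable_within k (add_mset A (add_mset B \<Gamma>) \<turnstile> \<Delta>)"
        by (simp add: add_mset_commute)
      then show ?thesis
        using ConjL(1) same(1) derivable_within_ConjL by blast
    next
      case (other \<Theta>)
      with IH[OF ConjL(1,3), of F "add_mset A (add_mset B \<Theta>)"] ConjL(1)
        derivable_within_ConjL[of k A B "add_mset F \<Theta>" \<Delta>]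
      show ?thesis
        by (simp add: add_mset_commute)
    qed
  next
    case (DisjL k A B \<Gamma>')
    from DisjL(2) show ?thesis
    proof (cases rule: add_mset_twice_eq_cases)
      case same
      have "derivable_within k (add_mset A (add_mset A \<Gamma>) \<turnstile> \<Delta>)"
        using inversion_left[OF left_components.intros(2), of k A B "add_mset A \<Gamma>" \<Delta>] DisjL(3) same
        by (simp add: add_mset_commute)
      moreover have "derivable_within k (add_mset B (add_mset B \<Gamma>) \<turnstile> \<Delta>)"
        using inversion_left[OF left_components.intros(3), of k A B "add_mset B \<Gamma>" \<Delta>] DisjL(4) same
        by (simp add: add_mset_commute)
      ultimately show ?thesis
        using IH[OF DisjL(1)] DisjL(1) same(1) derivable_within_DisjL by blast
    next
      case (other \<Theta>)
      with IH[OF DisjL(1,3), of F "add_mset A \<Theta>"] IH[OF DisjL(1,4), of F "add_mset B \<Theta>"] DisjL(1)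
        derivable_within_DisjL[of k A "add_mset F \<Theta>" \<Delta> B]
      show ?thesis
        by (simp add: add_mset_commute)
    qed
  next
    case (ImplL k A B \<Gamma>')
    from ImplL(2) show ?thesis
    proof (cases rule: add_mset_twice_eq_cases)
      case same
      have "derivable_within k (add_mset (A \<^bold>\<rightarrow> B) \<Gamma> \<turnstile> add_mset A \<Delta>)"
        using IH[OF ImplL(1,3)] same by simp
      moreover have "derivable_within k (add_mset B (add_mset B \<Gamma>) \<turnstile> \<Delta>)"
        using inversion_left[OF left_components.intros(4), of k A B "add_mset B \<Gamma>" \<Delta>] ImplL(4) same
        by (simp add: add_mset_commute)
      ultimately show ?thesis
        using IH[OF ImplL(1)] ImplL(1) same(1) derivable_within_ImplL by blast
    next
      case (other \<Theta>)
      with IH[OF ImplL(1,3), of F "add_mset (A \<^bold>\<rightarrow> B) \<Theta>"] IH[OF ImplL(1,4), of F "add_mset B \<Theta>"]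
        ImplL(1)
        derivable_within_ImplL[of k A B "add_mset F \<Theta>" \<Delta>]
      show ?thesis
        by (simp add: add_mset_commute)
    qed
  next
    case (ConjR k A B \<Delta>')
    with IH[OF ConjR(1,3)] IH[OF ConjR(1,4)] show ?thesis
      by (auto intro!: derivable_within_ConjR)
  next
    case (DisjR k A B \<Delta>')
    with IH[OF DisjR(1,3)] show ?thesis
      by (auto intro!: derivable_within_DisjR)
  next
    case (ImplR k A B \<Delta>')
    with IH[OF ImplR(1,3), of F "add_mset A \<Gamma>"] show ?thesis
      by (simp add: derivable_within_ImplR add_mset_commute[of A F])
  qed
qed

lemma contraction_right_within:
  "derivable_within n (\<Gamma> \<turnstile> add_mset F (add_mset F \<Delta>)) \<Longrightarrow> derivable_within n (\<Gamma> \<turnstile> add_mset F \<Delta>)"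
proof (induction n arbitrary: F \<Gamma> \<Delta> rule: less_induct)
  case (less n)
  have IH: "derivable_within k (\<Gamma> \<turnstile> add_mset G \<Delta>)"
    if "n = Suc k" "derivable_within k (\<Gamma> \<turnstile> \<Delta>')" "\<Delta>' = add_mset G (add_mset G \<Delta>)"
    for k \<Gamma> \<Delta> \<Delta>' and G :: "'a form"
    using less.IH[of k \<Gamma> G \<Delta>] that by simp
  from less.prems show ?case
  proof (cases rule: derivable_within_cases)
    case (Init p \<Gamma>' \<Delta>')
    from Init(2) show ?thesis
    proof (cases rule: add_mset_twice_eq_cases)
      case same
      with Init(1) derivable_within_Init[of n p \<Gamma>' \<Delta>] show ?thesis
        by simp
    next
      case (other \<Theta>)
      with Init(1) derivable_within_Init[of n p \<Gamma>' "add_mset F \<Theta>"] show ?thesis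
        by (simp add: add_mset_commute)
    qed
  next
    case (BotL \<Gamma>')
    then show ?thesis
      by (auto intro: derivable_within_BotL)
  next
    case (ConjL k A B \<Gamma>')
    with IH[OF ConjL(1,3)] show ?thesis
      by (auto intro!: derivable_within_ConjL)
  next
    case (DisjL k A B \<Gamma>')
    with IH[OF DisjL(1,3)] IH[OF DisjL(1,4)] show ?thesis
      by (auto intro!: derivable_within_DisjL)
  next
    case (ImplL k A B \<Gamma>')
    with IH[OF ImplL(1,3), of F "add_mset A \<Delta>"] IH[OF ImplL(1,4)]
    show ?thesis
      by (simp add: derivable_within_ImplL add_mset_commute[of A F])
  next
    case (ConjR k A B \<Delta>')
    from ConjR(2) show ?thesis
    proof (cases rule: add_mset_twice_eq_cases)
      case same
      have "derivable_within k (\<Gamma> \<turnstile> add_mset A (add_mset A \<Delta>))"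
        using inversion_right[OF right_components.intros(1), of k \<Gamma> A B "add_mset A \<Delta>"] ConjR(3) same
        by (simp add: add_mset_commute)
      moreover have "derivable_within k (\<Gamma> \<turnstile> add_mset B (add_mset B \<Delta>))"
        using inversion_right[OF right_components.intros(2), of k \<Gamma> A B "add_mset B \<Delta>"] ConjR(4) same
        by (simp add: add_mset_commute)
      ultimately show ?thesis
        using IH[OF ConjR(1)] ConjR(1) same(1) derivable_within_ConjR by blast
    next
      case (other \<Theta>)
      with IH[OF ConjR(1,3), of F "add_mset A \<Theta>"] IH[OF ConjR(1,4), of F "add_mset B \<Theta>"] ConjR(1)
        derivable_within_ConjR[of k \<Gamma> A "add_mset F \<Theta>" B]
      show ?thesis
        by (simp add: add_mset_commute)
    qed
  next
    case (DisjR k A B \<Delta>')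
    from DisjR(2) show ?thesis
    proof (cases rule: add_mset_twice_eq_cases)
      case same
      have "derivable_within k (\<Gamma> \<turnstile> add_mset (A \<^bold>\<or> B) (add_mset A (add_mset B \<Delta>)))"
        using DisjR(3) same by (simp add: add_mset_commute)
      then have "derivable_within k (\<Gamma> \<turnstile> add_mset A (add_mset A (add_mset B (add_mset B \<Delta>))))"
        using inversion_right[OF right_components.intros(3)] by (fastforce simp: add_mset_commute)
      then have "derivable_within k (\<Gamma> \<turnstile> add_mset A (add_mset B (add_mset B \<Delta>)))"
        by (rule IH[OF DisjR(1) _ refl])
      then have "derivable_within k (\<Gamma> \<turnstile> add_mset B (add_mset B (add_mset A \<Delta>)))"
        by (simp add: add_mset_commute)
      then have "derivable_within k (\<Gamma> \<turnstile> add_mset B (add_mset A \<Delta>))"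
        by (rule IH[OF DisjR(1) _ refl])
      then have "derivable_within k (\<Gamma> \<turnstile> add_mset A (add_mset B \<Delta>))"
        by (simp add: add_mset_commute)
      then show ?thesis
        using DisjR(1) same(1) derivable_within_DisjR by blast
    next
      case (other \<Theta>)
      with IH[OF DisjR(1,3), of F "add_mset A (add_mset B \<Theta>)"] DisjR(1)
        derivable_within_DisjR[of k \<Gamma> A B "add_mset F \<Theta>"]
      show ?thesis
        by (simp add: add_mset_commute)
    qed
  next
    case (ImplR k A B \<Delta>')
    from ImplR(2) show ?thesis
    proof (cases rule: add_mset_twice_eq_cases)
      case same
      \<comment> \<open>The step discarded the second copy, so its premiss also yields the contracted sequent.\<close>
      with ImplR show ?thesis
        by (auto intro: derivable_within_ImplR)
    next
      case (other \<Theta>)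
      with ImplR
        derivable_within_ImplR[of k A \<Gamma> B "add_mset F \<Theta>"]
      show ?thesis
        by (simp add: add_mset_commute)
    qed
  qed
qed

theorem lemma4p6:
  shows "hp_admissible (contraction_left :: 'v::countable rule1)
       \<and> hp_admissible (contraction_right :: 'v rule1)"
  unfolding hp_admissible_def contraction_left_def contraction_right_def
  by (auto intro: contraction_left_within contraction_right_within)

end
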